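(* Let $f,g_1,\ldots,g_m\in\mathbb{R}[\mathbf{x}]$ be real polynomials in $\mathbf{x}=(x_1,\ldots,x_n)$, and let $\mathbf{K}=\{\mathbf{x}\in\mathbb{R}^n : g_j(\mathbf{x})\ge 0,\ j=1,\ldots,m\}$. Assume that $\mathbf{K}$ is compact, that $0\le g_j\le 1$ on $\mathbf{K}$ for all $j=1,\ldots,m$, and that the family $\{g_j,\,1-g_j : j=1,\ldots,m\}$ generates the algebra $\mathbb{R}[\mathbf{x}]$. Let $f^*=\min\{f(\mathbf{x}) : \mathbf{x}\in\mathbf{K}\}$. For $d\in\mathbb{N}$ consider the optimization problem $$\tilde{\mathbf{P}}_d:\quad \min_{\mathbf{x}}\Big\{f(\mathbf{x}) : \prod_{j=1}^m g_j(\mathbf{x})^{\alpha_j}(1-g_j(\mathbf{x}))^{\beta_j}\ge 0,\ \ (\alpha,\beta)\in\mathbb{N}^{2m}_d\Big\}.$$ Then for every $\epsilon>0$ there exists $d_\epsilon\in\mathbb{N}$ such that for every $d\ge d_\epsilon$ the optimal value $\rho_d$ of the Lagrangian relaxation of $\tilde{\mathbf{P}}_d$ satisfies $f^*-\epsilon\le\rho_d\le f^*$.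
   Context: $\mathbb{N}^{2m}_d=\{(\alpha,\beta)\in\mathbb{N}^m\times\mathbb{N}^m : \sum_{j=1}^m(\alpha_j+\beta_j)\le d\}$, where $\mathbb{N}$ includes $0$. The optimal value of the Lagrangian relaxation of $\tilde{\mathbf{P}}_d$ is $$\rho_d=\sup_{\lambda\ge 0}\ \inf_{\mathbf{x}\in\mathbb{R}^n}\Big\{f(\mathbf{x})-\sum_{(\alpha,\beta)\in\mathbb{N}^{2m}_d}\lambda_{\alpha\beta}\Big(\prod_{j=1}^m g_j(\mathbf{x})^{\alpha_j}\Big)\Big(\prod_{j=1}^m(1-g_j(\mathbf{x}))^{\beta_j}\Big)\Big\},$$ where $\lambda=(\lambda_{\alpha\beta})_{(\alpha,\beta)\in\mathbb{N}^{2m}_d}$ is a real vector with nonnegative entries and values are taken in the extended reals. The set $\mathbf{K}$ is nonempty, so that the minimum $f^*$ exists. *)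

theory Defs
  imports "HOL-Analysis.Analysis" "HOL-Library.Poly_Mapping"
begin

text \<open>
  The polynomial ring over the reals in finitely many variables indexed by \<open>'n\<close>, as a monoid
  algebra: a monomial is its exponent vector \<open>'n \<Rightarrow>\<^sub>0 nat\<close>, and the product is convolution.
\<close>

type_synonym 'n rpoly = "('n \<Rightarrow>\<^sub>0 nat) \<Rightarrow>\<^sub>0 real"

definition rconst :: "real \<Rightarrow> 'n rpoly" where
  "rconst c = Poly_Mapping.single 0 c"

definition peval :: "'n::finite rpoly \<Rightarrow> real ^ 'n \<Rightarrow> real" where
  "peval p x =
    (\<Sum>e\<in>Poly_Mapping.keys p.
       Poly_Mapping.lookup p e * (\<Prod>i\<in>UNIV. (x $ i) ^ Poly_Mapping.lookup e i))"

text \<open>The (unital) real subalgebra of the polynomial ring generated by a set of polynomials.\<close>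

inductive_set generated_algebra :: "'n rpoly set \<Rightarrow> 'n rpoly set" for S where
  gen: "p \<in> S \<Longrightarrow> p \<in> generated_algebra S"
| const: "rconst c \<in> generated_algebra S"
| add: "p \<in> generated_algebra S \<Longrightarrow> q \<in> generated_algebra S \<Longrightarrow> p + q \<in> generated_algebra S"
| mult: "p \<in> generated_algebra S \<Longrightarrow> q \<in> generated_algebra S \<Longrightarrow> p * q \<in> generated_algebra S"

definition semialg_set :: "('m \<Rightarrow> 'n::finite rpoly) \<Rightarrow> (real ^ 'n) set" where
  "semialg_set g = {x. \<forall>j. peval (g j) x \<ge> 0}"

text \<open>
  The minimum of \<open>f\<close> over \<open>K\<close>: the least element of the set of values; meaningful only if the
  minimum is attained.
\<close>

definition min_value :: "'n::finite rpoly \<Rightarrow> (real ^ 'n) set \<Rightarrow> real" where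
  "min_value f K = (LEAST v. v \<in> peval f ` K)"

text \<open>
  The optimal value of the Lagrangian relaxation of \<open>min {F x | H i x \<ge> 0 for all i \<in> I}\<close>,
  with \<open>I\<close> finite. Multipliers outside \<open>I\<close> are irrelevant.
\<close>

definition lagrangian_value :: "('x \<Rightarrow> real) \<Rightarrow> 'i set \<Rightarrow> ('i \<Rightarrow> 'x \<Rightarrow> real) \<Rightarrow> ereal" where
  "lagrangian_value F I H =
    (SUP l \<in> {l. \<forall>i\<in>I. (0::real) \<le> l i}. INF x. ereal (F x - (\<Sum>i\<in>I. l i * H i x)))"

definition multi_indices :: "nat \<Rightarrow> (('m::finite \<Rightarrow> nat) \<times> ('m \<Rightarrow> nat)) set" where
  "multi_indices d = {(\<alpha>, \<beta>). (\<Sum>j\<in>UNIV. \<alpha> j + \<beta> j) \<le> d}"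

definition product_constraint ::
    "('m::finite \<Rightarrow> 'n::finite rpoly) \<Rightarrow> ('m \<Rightarrow> nat) \<times> ('m \<Rightarrow> nat) \<Rightarrow> real ^ 'n \<Rightarrow> real" where
  "product_constraint g = (\<lambda>(\<alpha>, \<beta>) x.
     (\<Prod>j\<in>UNIV. peval (g j) x ^ \<alpha> j) * (\<Prod>j\<in>UNIV. (1 - peval (g j) x) ^ \<beta> j))"

definition rho :: "'n::finite rpoly \<Rightarrow> ('m::finite \<Rightarrow> 'n rpoly) \<Rightarrow> nat \<Rightarrow> ereal" where
  "rho f g d = lagrangian_value (peval f) (multi_indices d) (product_constraint g)"

end

theory Submission
  imports Defs
begin

text \<open>
  Since \<open>0 \<le> g\<^sub>j \<le> 1\<close> on \<open>K\<close>, every \<open>product_constraint\<close> is nonnegative there, so a minimizer of \<open>f\<close>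
  on \<open>K\<close> bounds each inner infimum by \<open>fstar\<close>. For the lower bound it is enough to write
  \<open>f - (fstar - \<epsilon>)\<close>, which is positive on \<open>K\<close>, as a combination with nonnegative coefficients of the products
  \<open>\<Prod>j. g\<^sub>j ^ \<alpha>\<^sub>j * (1 - g\<^sub>j) ^ \<beta>\<^sub>j\<close>: with these coefficients as multipliers the Lagrangian is the
  constant \<open>fstar - \<epsilon>\<close>, and this works for all \<open>d\<close> at least the total degree that occurs.

  The representation (\<open>krivine_representation\<close>) comes from moving to the coordinates \<open>y = g(x)\<close>.
  Since the \<open>g\<^sub>j\<close> generate the polynomial ring, the map \<open>g\<close> has a polynomial left inverse \<open>P\<close>, and
  \<open>f\<close> is a polynomial \<open>F\<close> in \<open>g\<close>. The image of \<open>g\<close> is then the zero set of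
  \<open>Z(y) = \<bar>y - g(P(y))\<bar>\<^sup>2\<close>, and a point of the unit cube lies in this image only if it is \<open>g(x)\<close> for
  some \<open>x\<close> in the semialgebraic set. So if \<open>f > 0\<close> on that set, then \<open>F > 0\<close> on the part of the cube where
  \<open>Z\<close> vanishes, and by compactness \<open>F + C * Z > 0\<close> on the whole cube for a large constant \<open>C\<close>
  (\<open>penalty_makes_positive\<close>). A polynomial that is positive on the cube has nonnegative
  coefficients in the Bernstein basis of high enough degree (\<open>positive_on_cube_bernstein\<close>), because
  these coefficients converge uniformly to its values on the grid \<open>k / N\<close>. Substituting \<open>y = g(x)\<close> in
  that expansion removes the penalty, since \<open>Z(g(x)) = 0\<close>, and leaves the identity wanted for \<open>f\<close>.
\<close>

section \<open>Bernstein coefficients\<close>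

text \<open>
  By \<open>C(k,e) C(N,k) = C(N,e) C(N-e,k-e)\<close>, the right-hand side is \<open>t\<^sup>e\<close> times the binomial expansion of
  \<open>(t + (1 - t)) ^ (N - e)\<close>.
\<close>

lemma power_eq_bernstein_sum:
  fixes t :: real
  assumes "e \<le> N"
  shows "t ^ e = (\<Sum>k\<le>N. real (k choose e) / real (N choose e) *
           (real (N choose k) * t ^ k * (1 - t) ^ (N - k)))"
proof -
  let ?F = "\<lambda>k. real (k choose e) / real (N choose e) *
           (real (N choose k) * t ^ k * (1 - t) ^ (N - k))"
  have "(\<Sum>k\<le>N. ?F k) = (\<Sum>k\<in>{0+e..(N-e)+e}. ?F k)"
    using assms by (intro sum.mono_neutral_right) (auto simp: binomial_eq_0)
  also have "\<dots> = (\<Sum>i\<le>N-e. ?F (i + e))"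
    by (simp only: sum.shift_bounds_cl_nat_ivl atMost_atLeast0)
  also have "\<dots> = (\<Sum>i\<le>N-e. t ^ e * (real ((N-e) choose i) * t ^ i * (1 - t) ^ (N - e - i)))"
  proof (intro sum.cong refl)
    fix i assume "i \<in> {..N-e}"
    hence le: "i + e \<le> N" using assms by auto
    have "(N choose (i+e)) * ((i+e) choose e) = (N choose e) * ((N-e) choose i)"
      using choose_mult[of e "i+e" N] le by simp
    hence eq: "real ((i+e) choose e) * real (N choose (i+e)) = real (N choose e) * real ((N-e) choose i)"
      by (metis mult.commute of_nat_mult)
    have "real (N choose e) \<noteq> 0" using assms by simp
    hence "real ((i+e) choose e) / real (N choose e) * real (N choose (i+e)) = real ((N-e) choose i)"
      using eq by (simp add: field_simps)
    thus "?F (i + e) = t ^ e * (real ((N-e) choose i) * t ^ i * (1 - t) ^ (N - e - i))"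
      by (simp add: power_add mult.assoc[symmetric] add.commute)
  qed
  also have "\<dots> = t ^ e * (t + (1 - t)) ^ (N - e)"
    by (simp only: binomial_ring sum_distrib_left)
  finally show ?thesis by simp
qed

text \<open>
  The ratio is the product of the factors \<open>(k - i) / (N - i)\<close> for \<open>i < e\<close>; each of them differs from
  \<open>k / N\<close> by at most \<open>i / (N - i)\<close>. The bound does not depend on \<open>k\<close>, which gives the uniform convergence
  of Bernstein coefficients.
\<close>

lemma binomial_ratio_near_power:
  assumes "k \<le> N" and "e < N"
  shows "\<bar>real (k choose e) / real (N choose e) - (real k / real N) ^ e\<bar> \<le> (real e)\<^sup>2 / real (N - e)"
  using \<open>e < N\<close>
proof (induction e)
  case 0
  thus ?case by simp
next
  case (Suc e)
  let ?a = "real (k choose e) / real (N choose e)" and ?c = "(real k / real N) ^ e"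
  let ?b = "(real k - real e) / (real N - real e)" and ?d = "real k / real N"
  have absorb: "real (n choose Suc e) * real (Suc e) = real (n choose e) * (real n - real e)" for n
  proof (cases "e \<le> n")
    case True
    have "Suc e * (n choose Suc e) = (n - e) * (n choose e)"
      by (simp only: binomial_absorb_comp binomial_absorption)
    thus ?thesis using True by (metis mult.commute of_nat_diff of_nat_mult)
  qed (simp add: binomial_eq_0)
  have eN: "e < N" and pos: "real (N choose e) > 0" "real N - real e > 0"
    using Suc.prems by auto
  have "real (k choose Suc e) / real (N choose Suc e)
      = (real (k choose Suc e) * real (Suc e)) / (real (N choose Suc e) * real (Suc e))"
    by (simp del: of_nat_Suc)
  also have "\<dots> = ?a * ?b" by (simp only: absorb) simp
  finally have step: "real (k choose Suc e) / real (N choose Suc e) = ?a * ?b" .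
  have a01: "0 \<le> ?a" "?a \<le> 1"
    using pos assms(1) binomial_right_mono[of k N e] by auto
  have d01: "0 \<le> ?d" "?d \<le> 1" using assms(1) Suc.prems by (auto simp: divide_le_eq)
  have "?b - ?d = - (real e * (real N - real k) / (real N * (real N - real e)))"
    using pos Suc.prems by (simp add: field_simps)
  hence "\<bar>?b - ?d\<bar> = real e * (real N - real k) / (real N * (real N - real e))"
    using pos assms(1) by simp
  also have "\<dots> \<le> real e * real N / (real N * (real N - real e))"
    using pos assms(1) by (intro divide_right_mono mult_left_mono) auto
  also have "\<dots> = real e / real (N - e)" using Suc.prems by (simp add: of_nat_diff)
  finally have bd: "\<bar>?b - ?d\<bar> \<le> real e / real (N - e)" .
  have "?a * ?b - ?c * ?d = ?a * (?b - ?d) + ?d * (?a - ?c)" by (simp add: algebra_simps)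
  hence "\<bar>?a * ?b - ?c * ?d\<bar> \<le> \<bar>?a * (?b - ?d)\<bar> + \<bar>?d * (?a - ?c)\<bar>"
    by (simp only: abs_triangle_ineq)
  also have "\<dots> \<le> 1 * \<bar>?b - ?d\<bar> + 1 * \<bar>?a - ?c\<bar>"
    unfolding abs_mult using a01 d01 by (intro add_mono mult_right_mono) auto
  also have "\<dots> \<le> real e / real (N - e) + (real e)\<^sup>2 / real (N - e)"
    using bd Suc.IH[OF eN] by simp
  also have "\<dots> = (real e + (real e)\<^sup>2) / real (N - e)" by (simp add: add_divide_distrib)
  also have "\<dots> \<le> (real (Suc e))\<^sup>2 / real (N - Suc e)"
    using Suc.prems by (intro frac_le) (auto simp: power2_eq_square algebra_simps)
  finally show ?case by (simp add: step mult.commute)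
qed

text \<open>
  The coefficients of a monomial and of a polynomial with respect to the tensor Bernstein basis
  \<open>\<Prod>j. C(N,k\<^sub>j) y\<^sub>j ^ k\<^sub>j (1 - y\<^sub>j) ^ (N - k\<^sub>j)\<close>. They have this meaning for \<open>N\<close> at least every exponent
  in the polynomial.
\<close>

definition monomial_bernstein_coeff :: "nat \<Rightarrow> ('m::finite \<Rightarrow> nat) \<Rightarrow> ('m \<Rightarrow>\<^sub>0 nat) \<Rightarrow> real" where
  "monomial_bernstein_coeff N k e =
     (\<Prod>j\<in>UNIV. real (k j choose Poly_Mapping.lookup e j) / real (N choose Poly_Mapping.lookup e j))"

definition bernstein_coeff :: "nat \<Rightarrow> 'm::finite rpoly \<Rightarrow> ('m \<Rightarrow> nat) \<Rightarrow> real" where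
  "bernstein_coeff N p k =
     (\<Sum>e\<in>Poly_Mapping.keys p. Poly_Mapping.lookup p e * monomial_bernstein_coeff N k e)"

abbreviation bernstein_grid :: "nat \<Rightarrow> ('m::finite \<Rightarrow> nat) set" where
  "bernstein_grid N \<equiv> PiE UNIV (\<lambda>_. {..N})"

lemma bernstein_expansion:
  fixes p :: "'m::finite rpoly"
  assumes "\<And>e j. e \<in> Poly_Mapping.keys p \<Longrightarrow> Poly_Mapping.lookup e j \<le> N"
  shows "peval p y = (\<Sum>k\<in>bernstein_grid N. bernstein_coeff N p k *
           (\<Prod>j\<in>UNIV. real (N choose k j) * (y $ j) ^ k j * (1 - y $ j) ^ (N - k j)))"
proof -
  let ?B = "\<lambda>k. \<Prod>j\<in>UNIV. real (N choose k j) * (y $ j) ^ k j * (1 - y $ j) ^ (N - k j)"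
  have monomial: "(\<Prod>j\<in>UNIV. (y $ j) ^ Poly_Mapping.lookup e j)
      = (\<Sum>k\<in>bernstein_grid N. monomial_bernstein_coeff N k e * ?B k)"
    if "e \<in> Poly_Mapping.keys p" for e
  proof -
    have "(\<Prod>j\<in>UNIV. (y $ j) ^ Poly_Mapping.lookup e j) = (\<Prod>j\<in>UNIV. \<Sum>k\<le>N.
        real (k choose Poly_Mapping.lookup e j) / real (N choose Poly_Mapping.lookup e j) *
           (real (N choose k) * (y $ j) ^ k * (1 - y $ j) ^ (N - k)))"
      using assms[OF that] by (intro prod.cong refl power_eq_bernstein_sum)
    also have "\<dots> = (\<Sum>k\<in>bernstein_grid N. monomial_bernstein_coeff N k e * ?B k)"
      by (subst prod_sum_PiE) (simp_all only: finite finite_atMost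
        monomial_bernstein_coeff_def prod.distrib)
    finally show ?thesis .
  qed
  have "peval p y = (\<Sum>e\<in>Poly_Mapping.keys p. \<Sum>k\<in>bernstein_grid N.
      Poly_Mapping.lookup p e * monomial_bernstein_coeff N k e * ?B k)"
    unfolding peval_def by (intro sum.cong refl) (simp only: monomial sum_distrib_left mult.assoc)
  also have "\<dots> = (\<Sum>k\<in>bernstein_grid N. bernstein_coeff N p k * ?B k)"
    by (subst sum.swap) (simp only: bernstein_coeff_def sum_distrib_right)
  finally show ?thesis .
qed

text \<open>
  For each monomial, both sides of the comparison are products over the coordinates of numbers in
  \<open>[0, 1]\<close>, so the difference of the products is at most the sum of the differences of the factors.
\<close>

lemma bernstein_coeff_near_value:
  fixes p :: "'m::finite rpoly"
  assumes "\<And>e j. e \<in> Poly_Mapping.keys p \<Longrightarrow> Poly_Mapping.lookup e j \<le> D"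
    and "D < N" and "\<And>j. k j \<le> N"
  shows "\<bar>bernstein_coeff N p k - peval p (\<chi> j. real (k j) / real N)\<bar>
     \<le> (\<Sum>e\<in>Poly_Mapping.keys p. \<bar>Poly_Mapping.lookup p e\<bar>) * (real CARD('m) * (real D)\<^sup>2) / real (N - D)"
proof -
  let ?m = "\<lambda>e. \<Prod>j\<in>UNIV. (real (k j) / real N) ^ Poly_Mapping.lookup e j"
  have term_le: "\<bar>Poly_Mapping.lookup p e * (monomial_bernstein_coeff N k e - ?m e)\<bar>
     \<le> \<bar>Poly_Mapping.lookup p e\<bar> * (real CARD('m) * (real D)\<^sup>2 / real (N - D))"
    if e: "e \<in> Poly_Mapping.keys p" for e
  proof -
    have le: "Poly_Mapping.lookup e j \<le> D" for j using assms(1)[OF e] .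
    have "\<bar>monomial_bernstein_coeff N k e - ?m e\<bar>
       \<le> (\<Sum>j\<in>UNIV. \<bar>real (k j choose Poly_Mapping.lookup e j) / real (N choose Poly_Mapping.lookup e j)
             - (real (k j) / real N) ^ Poly_Mapping.lookup e j\<bar>)"
      unfolding monomial_bernstein_coeff_def real_norm_def[symmetric]
    proof (rule norm_prod_diff)
      fix j
      have "Poly_Mapping.lookup e j \<le> N" using le[of j] assms(2) by linarith
      hence "0 < real (N choose Poly_Mapping.lookup e j)" by simp
      thus "norm (real (k j choose Poly_Mapping.lookup e j) / real (N choose Poly_Mapping.lookup e j)) \<le> 1"
        using binomial_right_mono[OF assms(3)[of j], of "Poly_Mapping.lookup e j"] by simp
      show "norm ((real (k j) / real N) ^ Poly_Mapping.lookup e j) \<le> 1"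
        using assms(3)[of j] assms(2) by (auto intro!: power_le_one)
    qed
    also have "\<dots> \<le> (\<Sum>j\<in>(UNIV::'m set). (real D)\<^sup>2 / real (N - D))"
    proof (rule sum_mono)
      fix j
      have "\<bar>real (k j choose Poly_Mapping.lookup e j) / real (N choose Poly_Mapping.lookup e j)
             - (real (k j) / real N) ^ Poly_Mapping.lookup e j\<bar>
         \<le> (real (Poly_Mapping.lookup e j))\<^sup>2 / real (N - Poly_Mapping.lookup e j)"
        using le[of j] assms(2,3) by (intro binomial_ratio_near_power) auto
      also have "\<dots> \<le> (real D)\<^sup>2 / real (N - D)"
        using le[of j] assms(2) by (intro frac_le power_mono) auto
      finally show "\<bar>real (k j choose Poly_Mapping.lookup e j) / real (N choose Poly_Mapping.lookup e j)
             - (real (k j) / real N) ^ Poly_Mapping.lookup e j\<bar> \<le> (real D)\<^sup>2 / real (N - D)" .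
    qed
    also have "\<dots> = real CARD('m) * (real D)\<^sup>2 / real (N - D)" by simp
    finally show ?thesis unfolding abs_mult by (rule mult_left_mono) simp
  qed
  have "bernstein_coeff N p k - peval p (\<chi> j. real (k j) / real N)
      = (\<Sum>e\<in>Poly_Mapping.keys p. Poly_Mapping.lookup p e * (monomial_bernstein_coeff N k e - ?m e))"
    by (simp add: bernstein_coeff_def peval_def sum_subtractf right_diff_distrib)
  also have "\<bar>\<dots>\<bar> \<le> (\<Sum>e\<in>Poly_Mapping.keys p.
      \<bar>Poly_Mapping.lookup p e\<bar> * (real CARD('m) * (real D)\<^sup>2 / real (N - D)))"
    using term_le by (intro order.trans[OF sum_abs] sum_mono)
  also have "\<dots> = (\<Sum>e\<in>Poly_Mapping.keys p. \<bar>Poly_Mapping.lookup p e\<bar>)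
      * (real CARD('m) * (real D)\<^sup>2) / real (N - D)"
    by (simp add: sum_distrib_right sum_divide_distrib)
  finally show ?thesis .
qed

abbreviation unit_cube :: "(real ^ 'm) set" where
  "unit_cube \<equiv> {y. \<forall>j. 0 \<le> y $ j \<and> y $ j \<le> 1}"

lemma compact_unit_cube: "compact (unit_cube :: (real ^ 'm::finite) set)"
proof -
  have "unit_cube = (cbox 0 1 :: (real ^ 'm) set)"
    by (auto simp: cbox_def Basis_vec_def inner_axis)
  thus ?thesis by (simp add: compact_cbox)
qed

lemma bernstein_coeffs_nonneg:
  fixes p :: "'m::finite rpoly"
  assumes "\<delta> > 0" and "\<And>y. y \<in> unit_cube \<Longrightarrow> \<delta> \<le> peval p y"
  obtains N where "\<And>e j. e \<in> Poly_Mapping.keys p \<Longrightarrow> Poly_Mapping.lookup e j \<le> N"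
    and "\<And>k. k \<in> bernstein_grid N \<Longrightarrow> 0 \<le> bernstein_coeff N p k"
proof -
  define D where "D = Max (insert 0 ((\<lambda>(e, j). Poly_Mapping.lookup e j) ` (Poly_Mapping.keys p \<times> UNIV)))"
  have D: "Poly_Mapping.lookup e j \<le> D" if "e \<in> Poly_Mapping.keys p" for e j
    unfolding D_def using that by (intro Max_ge) auto
  define M where "M = (\<Sum>e\<in>Poly_Mapping.keys p. \<bar>Poly_Mapping.lookup p e\<bar>) * (real CARD('m) * (real D)\<^sup>2)"
  obtain s :: nat where s: "M / \<delta> < real s" using reals_Archimedean2 by blast
  \<comment> \<open>\<open>N - D > M / \<delta>\<close> makes the error bound \<open>M / (N - D)\<close> of the coefficients at most \<open>\<delta>\<close>.\<close>
  define N where "N = D + Suc s"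
  have "M / real (N - D) \<le> \<delta>"
    using s assms(1) by (simp add: N_def field_simps)
  hence *: "0 \<le> bernstein_coeff N p k" if "k \<in> bernstein_grid N" for k
  proof -
    have k: "k j \<le> N" for j using that by (auto simp: PiE_iff)
    hence grid_point: "(\<chi> j. real (k j) / real N) \<in> unit_cube"
      by (auto simp: N_def divide_le_eq simp flip: of_nat_Suc of_nat_add)
    define v where "v = peval p (\<chi> j. real (k j) / real N)"
    have "\<delta> \<le> v" unfolding v_def by (rule assms(2)[OF grid_point])
    moreover have "\<bar>bernstein_coeff N p k - v\<bar> \<le> M / real (N - D)"
      unfolding M_def v_def by (intro bernstein_coeff_near_value D k) (simp_all add: N_def)
    hence "\<bar>bernstein_coeff N p k - v\<bar> \<le> \<delta>" using \<open>M / real (N - D) \<le> \<delta>\<close> by (rule order.trans)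
    ultimately show ?thesis by linarith
  qed
  show thesis
  proof (rule that[of N])
    show "Poly_Mapping.lookup e j \<le> N" if "e \<in> Poly_Mapping.keys p" for e j
      using D[OF that, of j] by (simp add: N_def)
  qed (rule *)
qed

section \<open>Polynomials as functions\<close>

text \<open>
  Sums over different supports can only be compared after passing to a common index set.
\<close>

lemma peval_eq_sum_superset:
  assumes "finite A" "Poly_Mapping.keys p \<subseteq> A"
  shows "peval p x = (\<Sum>e\<in>A. Poly_Mapping.lookup p e * (\<Prod>i\<in>UNIV. (x $ i) ^ Poly_Mapping.lookup e i))"
  unfolding peval_def using assms
  by (intro sum.mono_neutral_left) (auto simp: in_keys_iff)

lemma peval_add [simp]: "peval (p + q) x = peval p x + peval q x"
proof -
  let ?A = "Poly_Mapping.keys p \<union> Poly_Mapping.keys q"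
  have "peval (p + q) x = (\<Sum>e\<in>?A. Poly_Mapping.lookup (p + q) e * (\<Prod>i\<in>UNIV. (x $ i) ^ Poly_Mapping.lookup e i))"
    using keys_add[of p q] by (intro peval_eq_sum_superset) auto
  also have "\<dots> = peval p x + peval q x"
    by (simp add: peval_eq_sum_superset[of ?A p] peval_eq_sum_superset[of ?A q]
        lookup_add distrib_right sum.distrib)
  finally show ?thesis .
qed

lemma peval_zero [simp]: "peval 0 x = 0"
  by (simp add: peval_def)

lemma peval_sum [simp]: "peval (sum p A) x = (\<Sum>a\<in>A. peval (p a) x)"
  by (induction A rule: infinite_finite_induct) simp_all

lemma peval_single [simp]:
  "peval (Poly_Mapping.single e c) x = c * (\<Prod>i\<in>UNIV. (x $ i) ^ Poly_Mapping.lookup e i)"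
  by (cases "c = 0") (simp_all add: peval_def)

lemma peval_rconst [simp]: "peval (rconst c) x = c"
  by (simp add: rconst_def)

lemma peval_one [simp]: "peval 1 x = 1"
  using peval_single[of 0 1 x] by simp

lemma peval_diff [simp]: "peval (p - q) x = peval p x - peval q x"
  using peval_add[of "p - q" q x] by simp

lemma sum_single_keys:
  fixes p :: "'n rpoly"
  shows "p = (\<Sum>e\<in>Poly_Mapping.keys p. Poly_Mapping.single e (Poly_Mapping.lookup p e))"
proof (rule poly_mapping_eqI)
  fix k
  show "Poly_Mapping.lookup p k = Poly_Mapping.lookup
      (\<Sum>e\<in>Poly_Mapping.keys p. Poly_Mapping.single e (Poly_Mapping.lookup p e)) k"
    by (cases "k \<in> Poly_Mapping.keys p")
       (auto simp: lookup_sum lookup_single when_def in_keys_iff)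
qed

lemma peval_mult [simp]: "peval (p * q) x = peval p x * peval q x"
proof -
  have "p * q = (\<Sum>e\<in>Poly_Mapping.keys p. \<Sum>e'\<in>Poly_Mapping.keys q.
     Poly_Mapping.single (e + e') (Poly_Mapping.lookup p e * Poly_Mapping.lookup q e'))"
  proof -
    have "p * q = (\<Sum>e\<in>Poly_Mapping.keys p. Poly_Mapping.single e (Poly_Mapping.lookup p e)) *
        (\<Sum>e\<in>Poly_Mapping.keys q. Poly_Mapping.single e (Poly_Mapping.lookup q e))"
      by (simp only: sum_single_keys[symmetric])
    thus ?thesis by (simp only: sum_product mult_single)
  qed
  also have "peval \<dots> x = peval p x * peval q x"
    unfolding peval_def[of p] peval_def[of q] sum_product
    by (simp add: lookup_add power_add prod.distrib mult_ac)
  finally show ?thesis .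
qed

lemma real_polynomial_function_nth: "real_polynomial_function (\<lambda>x :: real ^ 'n::finite. x $ i)"
  by (intro real_polynomial_function.intros(1) bounded_linear_vec_nth)

lemma real_polynomial_function_peval:
  "real_polynomial_function (peval (p :: 'n::finite rpoly))"
proof -
  have "real_polynomial_function (\<lambda>x :: real ^ 'n. x $ i)" for i
    by (rule real_polynomial_function_nth)
  hence "real_polynomial_function (\<lambda>x. \<Sum>e\<in>Poly_Mapping.keys p.
      Poly_Mapping.lookup p e * (\<Prod>i\<in>UNIV. (x $ i) ^ Poly_Mapping.lookup e i))"
    by (intro real_polynomial_function_sum real_polynomial_function.intros real_polynomial_function_prod
        real_polynomial_function_power real_polynomial_function.intros) auto
  thus ?thesis by (simp add: peval_def[abs_def])
qed

lemma real_polynomial_function_imp_peval: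
  fixes F :: "real ^ 'n::finite \<Rightarrow> real"
  assumes "real_polynomial_function F"
  obtains p where "F = peval p"
proof -
  have "\<exists>p. F = peval p" using assms
  proof induction
    case (linear F)
    let ?p = "\<Sum>i\<in>UNIV. Poly_Mapping.single (Poly_Mapping.single i 1) (F (axis i 1))"
    have "F x = peval ?p x" for x
    proof -
      have "F x = F (\<Sum>i\<in>UNIV. x $ i *\<^sub>R axis i 1)"
        using basis_expansion[of x] by (simp add: scalar_mult_eq_scaleR)
      also have "\<dots> = (\<Sum>i\<in>UNIV. x $ i * F (axis i 1))"
        using linear by (simp add: bounded_linear.linear linear_sum linear_scale)
      also have "\<dots> = peval ?p x"
        by (simp add: lookup_single when_def if_distrib[of "\<lambda>n. _ ^ n"] prod.delta mult.commute cong: if_cong)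
      finally show ?thesis .
    qed
    thus ?case by blast
  next
    case (const c)
    show ?case by (rule exI[of _ "rconst c"]) auto
  next
    case (add F G)
    thus ?case by (metis ext peval_add)
  next
    case (mult F G)
    thus ?case by (metis ext peval_mult)
  qed
  thus thesis using that by blast
qed

text \<open>
  A continuous positive function on the compact cube stays above some \<open>\<delta> > 0\<close>, which absorbs the
  deviation of the Bernstein coefficients from the values on the grid.
\<close>

lemma positive_on_cube_bernstein:
  fixes F :: "real ^ 'm::finite \<Rightarrow> real"
  assumes "real_polynomial_function F" and "\<And>y. y \<in> unit_cube \<Longrightarrow> 0 < F y"
  obtains N b where "\<And>k. k \<in> bernstein_grid N \<Longrightarrow> 0 \<le> b k"
    and "\<And>y. F y = (\<Sum>k\<in>bernstein_grid N. b k *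
           ((\<Prod>j\<in>UNIV. (y $ j) ^ k j) * (\<Prod>j\<in>UNIV. (1 - y $ j) ^ (N - k j))))"
proof -
  obtain p where p: "F = peval p" using real_polynomial_function_imp_peval[OF assms(1)] .
  have ne: "unit_cube \<noteq> ({} :: (real ^ 'm) set)" by (auto intro: exI[of _ 0])
  have "continuous_on unit_cube F"
    using assms(1) by (simp add: continuous_on_polymonial_function real_polynomial_function_eq)
  then obtain y0 where y0: "y0 \<in> unit_cube" "\<And>y. y \<in> unit_cube \<Longrightarrow> F y0 \<le> F y"
    using continuous_attains_inf[OF compact_unit_cube ne] by blast
  obtain N where N: "\<And>e j. e \<in> Poly_Mapping.keys p \<Longrightarrow> Poly_Mapping.lookup e j \<le> N"
    "\<And>k. k \<in> bernstein_grid N \<Longrightarrow> 0 \<le> bernstein_coeff N p k"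
    using bernstein_coeffs_nonneg[of "F y0" p] assms(2) y0 unfolding p by blast
  show thesis
  proof (rule that[of N "\<lambda>k. bernstein_coeff N p k * (\<Prod>j\<in>UNIV. real (N choose k j))"])
    show "0 \<le> bernstein_coeff N p k * (\<Prod>j\<in>UNIV. real (N choose k j))"
      if "k \<in> bernstein_grid N" for k
      using N(2)[OF that] by (simp add: prod_nonneg)
    show "F y = (\<Sum>k\<in>bernstein_grid N. bernstein_coeff N p k * (\<Prod>j\<in>UNIV. real (N choose k j)) *
           ((\<Prod>j\<in>UNIV. (y $ j) ^ k j) * (\<Prod>j\<in>UNIV. (1 - y $ j) ^ (N - k j))))" for y
      unfolding p using N(1) by (subst bernstein_expansion[of p N]) (simp_all add: prod.distrib mult.assoc)
  qed
qed

section \<open>Positivity certificates by reduction to the cube\<close>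

text \<open>
  Only the compact set where \<open>u \<le> 0\<close> needs the penalty, and there \<open>z\<close> has a positive minimum, so a
  large multiple of \<open>z\<close> outweighs the minimum of \<open>u\<close>.
\<close>

lemma penalty_makes_positive:
  fixes u z :: "'a::t2_space \<Rightarrow> real"
  assumes "compact S" "continuous_on S u" "continuous_on S z"
    and "\<And>y. y \<in> S \<Longrightarrow> 0 \<le> z y" and "\<And>y. y \<in> S \<Longrightarrow> z y = 0 \<Longrightarrow> 0 < u y"
  obtains C where "\<And>y. y \<in> S \<Longrightarrow> 0 < u y + C * z y"
proof -
  define A where "A = S \<inter> u -` {..0}"
  show thesis
  proof (cases "A = {}")
    case True
    hence "0 < u y + 0 * z y" if "y \<in> S" for y using that by (force simp: A_def)
    thus thesis by (rule that)
  next
    case False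
    have "closed (S \<inter> u -` {..0})"
      using continuous_closed_preimage[OF assms(2) compact_imp_closed[OF assms(1)]] by simp
    hence A: "compact A"
      using compact_Int_closed[OF assms(1), of "S \<inter> u -` {..0}"] by (simp add: A_def)
    have sub: "A \<subseteq> S" by (auto simp: A_def)
    obtain a where a: "a \<in> A" "\<And>y. y \<in> A \<Longrightarrow> z a \<le> z y"
      using continuous_attains_inf[OF A False continuous_on_subset[OF assms(3) sub]] by blast
    obtain c where c: "c \<in> A" "\<And>y. y \<in> A \<Longrightarrow> u c \<le> u y"
      using continuous_attains_inf[OF A False continuous_on_subset[OF assms(2) sub]] by blast
    have za: "0 < z a" using a(1) assms(4,5)[of a] by (force simp: A_def)
    have uc: "u c \<le> 0" using c(1) by (simp add: A_def)
    \<comment> \<open>With this \<open>C\<close>, the penalty on \<open>A\<close> is at least \<open>1 - u c\<close>, so the sum is at least \<open>1\<close>.\<close>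
    define C where "C = (1 - u c) / z a"
    have C: "0 \<le> C" using za uc by (simp add: C_def)
    have "0 < u y + C * z y" if "y \<in> S" for y
    proof (cases "y \<in> A")
      case True
      have "1 - u c = C * z a" using za by (simp add: C_def)
      also have "\<dots> \<le> C * z y" using a(2)[OF True] C by (rule mult_left_mono)
      finally show ?thesis using c(2)[OF True] by linarith
    next
      case False
      hence "0 < u y" using that by (auto simp: A_def)
      thus ?thesis using C assms(4)[OF that] by (simp add: add_pos_nonneg)
    qed
    thus thesis by (rule that)
  qed
qed

definition constraint_map :: "('m::finite \<Rightarrow> 'n::finite rpoly) \<Rightarrow> real ^ 'n \<Rightarrow> real ^ 'm" where
  "constraint_map g x = (\<chi> j. peval (g j) x)"

lemma generated_algebra_factors:
  assumes "p \<in> generated_algebra (range g \<union> range (\<lambda>j. 1 - g j))"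
  obtains F where "real_polynomial_function F" and "\<And>x. peval p x = F (constraint_map g x)"
proof -
  have coord: "real_polynomial_function (\<lambda>y :: real ^ 'b. y $ j)" for j
    by (rule real_polynomial_function_nth)
  have "\<exists>F. real_polynomial_function F \<and> (\<forall>x. peval p x = F (constraint_map g x))"
    using assms
  proof induction
    case (gen p)
    then obtain j where "p = g j \<or> p = 1 - g j" by blast
    thus ?case
    proof
      assume "p = g j"
      thus ?thesis using coord[of j] by (intro exI[of _ "\<lambda>y. y $ j"]) (simp add: constraint_map_def)
    next
      assume "p = 1 - g j"
      thus ?thesis using coord[of j]
        by (intro exI[of _ "\<lambda>y. 1 - y $ j"])
           (auto simp: constraint_map_def)
    qed
  next
    case (const c)
    show ?case by (rule exI[of _ "\<lambda>_. c"]) auto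
  next
    case (add p q)
    then obtain F G where "real_polynomial_function F" "\<And>x. peval p x = F (constraint_map g x)"
      "real_polynomial_function G" "\<And>x. peval q x = G (constraint_map g x)" by blast
    thus ?case by (intro exI[of _ "\<lambda>y. F y + G y"]) auto
  next
    case (mult p q)
    then obtain F G where "real_polynomial_function F" "\<And>x. peval p x = F (constraint_map g x)"
      "real_polynomial_function G" "\<And>x. peval q x = G (constraint_map g x)" by blast
    thus ?case by (intro exI[of _ "\<lambda>y. F y * G y"]) auto
  qed
  thus thesis using that by blast
qed

text \<open>The coordinates of \<open>x\<close> are themselves polynomials, hence polynomials in the constraints.\<close>

lemma constraint_map_left_inverse:
  fixes g :: "'m::finite \<Rightarrow> 'n::finite rpoly"
  assumes "generated_algebra (range g \<union> range (\<lambda>j. 1 - g j)) = UNIV"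
  obtains P where "polynomial_function P" and "\<And>x. P (constraint_map g x) = x"
proof -
  have "\<exists>F. real_polynomial_function F \<and> (\<forall>x. x $ i = F (constraint_map g x))" for i
  proof -
    have "real_polynomial_function (\<lambda>x :: real ^ 'n. x $ i)"
      by (rule real_polynomial_function_nth)
    then obtain p :: "'n rpoly" where p: "(\<lambda>x. x $ i) = peval p"
      by (rule real_polynomial_function_imp_peval)
    have "p \<in> generated_algebra (range g \<union> range (\<lambda>j. 1 - g j))" using assms by simp
    then obtain F where "real_polynomial_function F" "\<And>x. peval p x = F (constraint_map g x)"
      using generated_algebra_factors by blast
    thus ?thesis using p by (metis (no_types))
  qed
  then obtain F where F: "\<And>i. real_polynomial_function (F i)"
    "\<And>i x. x $ i = F i (constraint_map g x)" by metis
  show thesis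
  proof (rule that[of "\<lambda>y. \<chi> i. F i y"])
    show "polynomial_function (\<lambda>y. \<chi> i. F i y)"
      unfolding polynomial_function_iff_Basis_inner
      using F(1) by (auto simp: Basis_vec_def inner_axis)
    show "(\<chi> i. F i (constraint_map g x)) = x" for x
      by (simp add: F(2)[symmetric])
  qed
qed

text \<open>
  This is a form of Krivine's Positivstellensatz. The penalty \<open>Z\<close> measures how far \<open>y\<close> is from the image of the constraint map: at
  a zero of \<open>Z\<close> in the cube, \<open>P y\<close> is a point of the semialgebraic set with image \<open>y\<close>.
\<close>

lemma krivine_representation:
  fixes f :: "'n::finite rpoly" and g :: "'m::finite \<Rightarrow> 'n rpoly"
  assumes gen: "generated_algebra (range g \<union> range (\<lambda>j. 1 - g j)) = UNIV"
    and pos: "\<And>x. x \<in> semialg_set g \<Longrightarrow> 0 < peval f x"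
  obtains N b where "\<And>k. k \<in> bernstein_grid N \<Longrightarrow> 0 \<le> b k"
    and "\<And>x. peval f x =
      (\<Sum>k\<in>bernstein_grid N. b k * product_constraint g (k, \<lambda>j. N - k j) x)"
proof -
  obtain P where P: "polynomial_function P" "\<And>x. P (constraint_map g x) = x"
    using constraint_map_left_inverse[OF gen] by blast
  obtain F where F: "real_polynomial_function F" "\<And>x. peval f x = F (constraint_map g x)"
    using generated_algebra_factors[of f g] gen by auto
  define Z where "Z y = (\<Sum>j\<in>UNIV. (y $ j - peval (g j) (P y))\<^sup>2)" for y
  have Z0: "constraint_map g (P y) = y" if "Z y = 0" for y
  proof -
    have "\<forall>j. (y $ j - peval (g j) (P y))\<^sup>2 = 0"
      using that unfolding Z_def by (subst (asm) sum_nonneg_eq_0_iff) auto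
    thus ?thesis by (simp add: constraint_map_def vec_eq_iff)
  qed
  have "real_polynomial_function (\<lambda>y. peval (g j) (P y))" for j
    using real_polynomial_function_compose[OF P(1) real_polynomial_function_peval[of "g j"]]
    by (simp add: o_def)
  moreover have "real_polynomial_function (\<lambda>y :: real ^ 'm. y $ j)" for j
    by (rule real_polynomial_function_nth)
  ultimately have Z: "real_polynomial_function Z"
    unfolding Z_def[abs_def]
    by (intro real_polynomial_function_sum real_polynomial_function_power real_polynomial_function_diff) auto
  have cont: "continuous_on unit_cube H" if "real_polynomial_function H" for H :: "real ^ 'm \<Rightarrow> real"
    using that by (simp add: continuous_on_polymonial_function real_polynomial_function_eq)
  obtain C where C: "\<And>y. y \<in> unit_cube \<Longrightarrow> 0 < F y + C * Z y"
  proof (rule penalty_makes_positive[OF compact_unit_cube cont[OF F(1)] cont[OF Z]])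
    show "0 \<le> Z y" for y by (simp add: Z_def sum_nonneg)
    show "0 < F y" if "y \<in> unit_cube" "Z y = 0" for y
    proof -
      have "peval (g j) (P y) = y $ j" for j
        using arg_cong[OF Z0[OF that(2)], of "\<lambda>v. v $ j"] by (simp add: constraint_map_def)
      hence "P y \<in> semialg_set g" using that(1) by (simp add: semialg_set_def)
      thus ?thesis using pos[of "P y"] by (simp add: F(2) Z0[OF that(2)])
    qed
  qed blast
  have "real_polynomial_function (\<lambda>y. F y + C * Z y)"
    using F(1) Z real_polynomial_function.intros(2-4) by blast
  from positive_on_cube_bernstein[OF this C]
  obtain N b where b: "\<And>k. k \<in> bernstein_grid N \<Longrightarrow> 0 \<le> b k"
    "\<And>y. F y + C * Z y = (\<Sum>k\<in>bernstein_grid N. b k *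
           ((\<Prod>j\<in>UNIV. (y $ j) ^ k j) * (\<Prod>j\<in>UNIV. (1 - y $ j) ^ (N - k j))))" by blast
  show thesis
  proof (rule that[OF b(1)])
    fix x
    have "Z (constraint_map g x) = 0" by (simp add: Z_def P(2)) (simp add: constraint_map_def)
    hence "peval f x = F (constraint_map g x) + C * Z (constraint_map g x)" by (simp add: F(2))
    also have "\<dots> = (\<Sum>k\<in>bernstein_grid N. b k * product_constraint g (k, \<lambda>j. N - k j) x)"
      unfolding b(2) by (simp add: product_constraint_def constraint_map_def)
    finally show "peval f x = (\<Sum>k\<in>bernstein_grid N. b k * product_constraint g (k, \<lambda>j. N - k j) x)" .
  qed
qed

section \<open>Bounds on the Lagrangian relaxation\<close>

lemma finite_multi_indices: "finite (multi_indices d :: (('m::finite \<Rightarrow> nat) \<times> ('m \<Rightarrow> nat)) set)"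
proof (rule finite_subset)
  show "multi_indices d \<subseteq> bernstein_grid d \<times> (bernstein_grid d :: ('m \<Rightarrow> nat) set)"
  proof
    fix i :: "('m \<Rightarrow> nat) \<times> ('m \<Rightarrow> nat)"
    obtain \<alpha> \<beta> where i: "i = (\<alpha>, \<beta>)" by force
    assume "i \<in> multi_indices d"
    hence "\<alpha> j + \<beta> j \<le> d" for j
      using member_le_sum[of j UNIV "\<lambda>j. \<alpha> j + \<beta> j"] by (force simp: i multi_indices_def)
    hence "\<alpha> j \<le> d" "\<beta> j \<le> d" for j by (metis add_leD1, metis add_leD2)
    thus "i \<in> bernstein_grid d \<times> bernstein_grid d" by (auto simp: i)
  qed
qed (intro finite_cartesian_product finite_PiE; simp)

lemma lagrangian_value_le:
  assumes "\<And>i. i \<in> I \<Longrightarrow> 0 \<le> H i x"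
  shows "lagrangian_value F I H \<le> ereal (F x)"
  unfolding lagrangian_value_def
proof (rule SUP_least)
  fix l assume "l \<in> {l. \<forall>i\<in>I. (0::real) \<le> l i}"
  hence "0 \<le> (\<Sum>i\<in>I. l i * H i x)" using assms by (intro sum_nonneg) auto
  thus "(INF x. ereal (F x - (\<Sum>i\<in>I. l i * H i x))) \<le> ereal (F x)"
    by (intro INF_lower2[of x]) auto
qed

text \<open>
  An identity \<open>F - c = \<Sum> l\<^sub>i H\<^sub>i\<close> makes the Lagrangian constant, so its infimum is \<open>c\<close>. The identity may
  use a part \<open>J\<close> of the constraints, which lets one certificate serve all larger degrees.
\<close>

lemma lagrangian_value_ge:
  assumes "finite I" "J \<subseteq> I" "\<And>i. i \<in> J \<Longrightarrow> 0 \<le> l i"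
    and "\<And>x. F x - c = (\<Sum>i\<in>J. l i * H i x)"
  shows "ereal c \<le> lagrangian_value F I H"
  unfolding lagrangian_value_def
proof (rule SUP_upper2)
  let ?l = "\<lambda>i. if i \<in> J then l i else 0"
  show "?l \<in> {l. \<forall>i\<in>I. (0::real) \<le> l i}" using assms(3) by simp
  have "F x - (\<Sum>i\<in>I. ?l i * H i x) = c" for x
  proof -
    have "(\<Sum>i\<in>I. ?l i * H i x) = (\<Sum>i\<in>J. l i * H i x)"
      using assms(1,2) by (intro sum.mono_neutral_cong_right) auto
    thus ?thesis using assms(4)[of x] by simp
  qed
  thus "ereal c \<le> (INF x. ereal (F x - (\<Sum>i\<in>I. ?l i * H i x)))" by simp
qed

lemma min_value_attained:
  fixes f :: "'n::finite rpoly"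
  assumes "compact K" "K \<noteq> {}"
  obtains x where "x \<in> K" and "peval f x = min_value f K" and "\<And>y. y \<in> K \<Longrightarrow> min_value f K \<le> peval f y"
proof -
  have "continuous_on K (peval f)"
    by (simp add: continuous_on_polymonial_function real_polynomial_function_eq[symmetric] real_polynomial_function_peval)
  then obtain x where x: "x \<in> K" "\<And>y. y \<in> K \<Longrightarrow> peval f x \<le> peval f y"
    using continuous_attains_inf[OF assms] by blast
  have "min_value f K = peval f x"
    unfolding min_value_def using x by (intro Least_equality) auto
  thus thesis using x that[of x] by simp
qed

theorem corollary2p1:
  fixes f :: "'n::finite rpoly" and g :: "'m::finite \<Rightarrow> 'n rpoly"
    and K :: "(real ^ 'n) set" and fstar :: real
  defines "K \<equiv> semialg_set g"
  defines "fstar \<equiv> min_value f K"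
  assumes "K \<noteq> {}" and "compact K"
    and "\<And>j x. x \<in> K \<Longrightarrow> 0 \<le> peval (g j) x \<and> peval (g j) x \<le> 1"
    and "generated_algebra (range g \<union> range (\<lambda>j. 1 - g j)) = UNIV"
  shows "\<forall>\<epsilon>>0. \<exists>d\<^sub>\<epsilon>. \<forall>d\<ge>d\<^sub>\<epsilon>.
           ereal (fstar - \<epsilon>) \<le> rho f g d \<and> rho f g d \<le> ereal fstar"
proof (intro allI impI)
  fix \<epsilon> :: real assume "\<epsilon> > 0"
  obtain x where x: "x \<in> K" "peval f x = fstar" "\<And>y. y \<in> K \<Longrightarrow> fstar \<le> peval f y"
    using min_value_attained[OF assms(4,3)] unfolding fstar_def by metis
  have upper: "rho f g d \<le> ereal fstar" for d
    unfolding rho_def x(2)[symmetric]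
  proof (rule lagrangian_value_le)
    fix i :: "('m \<Rightarrow> nat) \<times> ('m \<Rightarrow> nat)" assume "i \<in> multi_indices d"
    show "0 \<le> product_constraint g i x"
      using assms(5)[OF x(1)]
      by (auto simp: product_constraint_def split: prod.split intro!: mult_nonneg_nonneg prod_nonneg)
  qed
  have "0 < peval (f - rconst (fstar - \<epsilon>)) y" if "y \<in> semialg_set g" for y
    using x(3)[of y] that \<open>\<epsilon> > 0\<close> by (simp add: K_def)
  then obtain N b where b: "\<And>k. k \<in> bernstein_grid N \<Longrightarrow> 0 \<le> b k"
    "\<And>y. peval (f - rconst (fstar - \<epsilon>)) y =
      (\<Sum>k\<in>bernstein_grid N. b k * product_constraint g (k, \<lambda>j. N - k j) y)"
    using krivine_representation[OF assms(6)] by blast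
  let ?J = "(\<lambda>k. (k, \<lambda>j. N - k j)) ` (bernstein_grid N :: ('m \<Rightarrow> nat) set)"
  \<comment> \<open>Each coordinate contributes \<open>k j + (N - k j) = N\<close> to the degree of a Bernstein product.\<close>
  have lower: "ereal (fstar - \<epsilon>) \<le> rho f g d" if "N * CARD('m) \<le> d" for d
    unfolding rho_def
  proof (rule lagrangian_value_ge[where l = "\<lambda>i. b (fst i)"])
    show "finite (multi_indices d)" by (rule finite_multi_indices)
    show "?J \<subseteq> multi_indices d"
    proof safe
      fix k :: "'m \<Rightarrow> nat" assume "k \<in> bernstein_grid N"
      hence "k j + (N - k j) = N" for j by (auto simp: PiE_iff)
      thus "(k, \<lambda>j. N - k j) \<in> multi_indices d" using that by (simp add: multi_indices_def mult.commute)
    qed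
    show "0 \<le> b (fst i)" if "i \<in> ?J" for i using that b(1) by auto
    show "peval f y - (fstar - \<epsilon>) = (\<Sum>i\<in>?J. b (fst i) * product_constraint g i y)" for y
      using b(2)[of y] by (subst sum.reindex) (auto simp: inj_on_def)
  qed
  show "\<exists>d\<^sub>\<epsilon>. \<forall>d\<ge>d\<^sub>\<epsilon>. ereal (fstar - \<epsilon>) \<le> rho f g d \<and> rho f g d \<le> ereal fstar"
    using lower upper by blast
qed

end
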